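(* Every bipartite co-cluster graph is an exact $k$-leaf power for every integer $k\ge5$.
   Context: Graphs are finite, simple, undirected and nonempty. A graph $G$ is an exact $k$-leaf power if there is a tree $T$ whose leaf set is $V(G)$ such that for distinct $u,v\in V(G)$, $uv\in E(G)$ if and only if $\operatorname{dist}_T(u,v)=k$; the vertex of a one-vertex tree counts as a leaf. A bipartite graph $G=(X,Y;E)$ with bipartition classes $X,Y$ is a bipartite co-cluster graph if there are partitions into pairwise disjoint sets $X=X_0\,\dot\cup\, X_1\,\dot\cup\cdots\dot\cup\, X_t$ and $Y=Y_0\,\dot\cup\, Y_1\,\dot\cup\cdots\dot\cup\, Y_t$, where $X_i$ and $Y_i$ are nonempty for $i\ge1$ ($X_0,Y_0$ may be empty), such that for $x\in X$, $y\in Y$: $xy\notin E(G)$ if and only if $x\in X_i$ and $y\in Y_i$ for some $i\in\{1,\ldots,t\}$. *)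

theory Defs
  imports
    "Graph_Theory.Graph_Theory"
    "HOL-Library.Disjoint_Sets"
begin

text \<open>
  Finite simple undirected graphs are the symmetric loop-free finite digraphs of locale
  \<^locale>\<open>pair_graph\<close>: an undirected edge is represented by both of its orientations.

  In this representation every edge yields a closed walk \<open>a, b, a\<close>, which counts as a
  \<open>cycle\<close> in the library; hence the library's \<open>forest\<close> and \<open>tree\<close> are not the undirected
  notions. A library cycle on at least three arcs is a cycle in the undirected sense.
\<close>

definition undirected_tree :: "'v pair_pre_digraph \<Rightarrow> bool" where
  "undirected_tree T \<longleftrightarrow>
     pair_graph T \<and> connected (with_proj T) \<and>
     \<not> (\<exists>p. pre_digraph.cycle (with_proj T) p \<and> 3 \<le> length p)"

text \<open>In a symmetric digraph, the out-degree is the undirected degree.\<close>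

definition leaves :: "'v pair_pre_digraph \<Rightarrow> 'v set" where
  "leaves T = {v \<in> pverts T. out_degree (with_proj T) v = 1 \<or> pverts T = {v}}"

definition graph_dist :: "'v pair_pre_digraph \<Rightarrow> 'v \<Rightarrow> 'v \<Rightarrow> ereal" where
  "graph_dist T u v = wf_digraph.\<mu> (with_proj T) (\<lambda>_. 1) u v"

text \<open>
  The vertices of \<open>G\<close> occur in the tree as \<open>Inl v\<close>; the type \<^typ>\<open>'a + nat\<close> always has
  enough further elements for the internal vertices, even when \<^typ>\<open>'a\<close> is finite.
\<close>

definition exact_leaf_power :: "nat \<Rightarrow> 'a pair_pre_digraph \<Rightarrow> bool" where
  "exact_leaf_power k G \<longleftrightarrow>
     (\<exists>T :: ('a + nat) pair_pre_digraph.
        undirected_tree T \<and> leaves T = Inl ` pverts G \<and>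
        (\<forall>u \<in> pverts G. \<forall>v \<in> pverts G. u \<noteq> v \<longrightarrow>
           ((u, v) \<in> parcs G \<longleftrightarrow> graph_dist T (Inl u) (Inl v) = ereal (real k))))"

definition bipartition :: "'a pair_pre_digraph \<Rightarrow> 'a set \<Rightarrow> 'a set \<Rightarrow> bool" where
  "bipartition G X Y \<longleftrightarrow>
     X \<union> Y = pverts G \<and> X \<inter> Y = {} \<and> parcs G \<subseteq> X \<times> Y \<union> Y \<times> X"

definition bipartite_co_cluster :: "'a pair_pre_digraph \<Rightarrow> bool" where
  "bipartite_co_cluster G \<longleftrightarrow>
     (\<exists>X Y. bipartition G X Y \<and>
       (\<exists>(t :: nat) (A :: nat \<Rightarrow> 'a set) (B :: nat \<Rightarrow> 'a set).
          X = (\<Union>i\<in>{0..t}. A i) \<and> disjoint_family_on A {0..t} \<and>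
          Y = (\<Union>i\<in>{0..t}. B i) \<and> disjoint_family_on B {0..t} \<and>
          (\<forall>i\<in>{1..t}. A i \<noteq> {} \<and> B i \<noteq> {}) \<and>
          (\<forall>x\<in>X. \<forall>y\<in>Y. (x, y) \<notin> parcs G \<longleftrightarrow> (\<exists>i\<in>{1..t}. x \<in> A i \<and> y \<in> B i))))"

end

theory Submission
  imports Defs
begin

text \<open>
  A bipartite co-cluster graph is described by a labelling \<open>\<phi>\<close> of its vertices such that
  \<open>x \<in> X\<close> and \<open>y \<in> Y\<close> are adjacent iff \<open>\<phi> x \<noteq> \<phi> y\<close>: label the classes \<open>A i\<close> and \<open>B i\<close> by
  \<open>i\<close>, except that \<open>B 0\<close> gets the fresh label \<open>t + 1\<close>, since \<open>A 0\<close> and \<open>B 0\<close> are completely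
  joined (\<open>co_cluster_labelling\<close>).

  The tree has a centre, from which one branch issues for each label \<open>i\<close>. The branch is a path
  whose node at depth 1 carries the vertices of \<open>X\<close> with label \<open>i\<close> as leaves, and whose node
  at depth \<open>k - 3\<close> carries those of \<open>Y\<close>. So leaves from \<open>X\<close> have depth 2 and leaves from \<open>Y\<close>
  have depth \<open>k - 2\<close>. Leaves on different branches are joined through the centre, at distance
  \<open>4\<close> (both in \<open>X\<close>), \<open>2 k - 4\<close> (both in \<open>Y\<close>) or \<open>k\<close> (one in each); since \<open>k \<ge> 5\<close>, only the last
  value equals \<open>k\<close>. Leaves on the same branch have distance 2 or \<open>k - 2\<close>, which is less than
  \<open>k\<close>. This is \<open>exact_leaf_power_of_labelling\<close>.

  The centre must not become a leaf itself, so at least two labels have to occur. An edge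
  provides two labels. An edgeless graph with at least two vertices is handled by the
  same construction with \<open>Y = {}\<close> and pairwise distinct labels, and a single vertex is its own
  tree (\<open>exact_leaf_power_edgeless\<close>).

  The tree is specified by a parent function together with a height function. In such a graph
  the walks along parents give connectedness and upper bounds on distances, the highest vertex
  of a hypothetical cycle gives acyclicity, and a potential built from the
  height gives the lower bound for leaves on different branches.
\<close>

section \<open>Trees given by a parent function\<close>

definition parent_graph :: "'v set \<Rightarrow> 'v \<Rightarrow> ('v \<Rightarrow> 'v) \<Rightarrow> 'v pair_pre_digraph" where
  "parent_graph V r par =
     \<lparr>pverts = V, parcs = (\<lambda>v. (v, par v)) ` (V - {r}) \<union> (\<lambda>v. (par v, v)) ` (V - {r})\<rparr>"

text \<open>
  The height function certifies that iterating the parent function ends at the root, which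
  excludes cycles among the parent links.
\<close>

locale rooted_tree =
  fixes V :: "'v set" and r :: 'v and par :: "'v \<Rightarrow> 'v" and h :: "'v \<Rightarrow> nat"
  assumes finite_V: "finite V"
    and root_in: "r \<in> V"
    and height_root: "h r = 0"
    and parent_in: "v \<in> V \<Longrightarrow> v \<noteq> r \<Longrightarrow> par v \<in> V"
    and height_parent: "v \<in> V \<Longrightarrow> v \<noteq> r \<Longrightarrow> h v = Suc (h (par v))"
begin

abbreviation T :: "'v pair_pre_digraph" where
  "T \<equiv> parent_graph V r par"

lemma pverts_T: "pverts T = V"
  by (simp add: parent_graph_def)

lemma parcs_T_iff:
  "(a, b) \<in> parcs T \<longleftrightarrow> a \<in> V - {r} \<and> b = par a \<or> b \<in> V - {r} \<and> a = par b"
  by (auto simp: parent_graph_def)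

lemma pair_graph_T: "pair_graph T"
proof unfold_locales
  show "finite (pverts T)" "finite (parcs T)"
    using finite_V by (auto simp: parent_graph_def)
  show "fst e \<in> pverts T" "snd e \<in> pverts T" if "e \<in> parcs T" for e
    using that by (auto simp: parent_graph_def intro: parent_in)
  show "fst e \<noteq> snd e" if "e \<in> parcs T" for e
    using that by (cases e) (auto simp: parcs_T_iff dest: height_parent)
  show "symmetric (with_proj T)"
    by (auto simp: symmetric_def sym_def parcs_T_iff)
qed

sublocale G: pair_graph T
  by (rule pair_graph_T)

subsection \<open>Walks to ancestors\<close>

lemma ancestor:
  assumes "u \<in> V" "a \<le> h u"
  shows "(par ^^ a) u \<in> V \<and> h ((par ^^ a) u) = h u - a"
  using assms(2)
proof (induction a)
  case (Suc a)
  then have *: "(par ^^ a) u \<in> V" "h ((par ^^ a) u) = h u - a" by auto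
  then have "(par ^^ a) u \<noteq> r" using Suc.prems height_root by auto
  then show ?case using parent_in[OF *(1)] height_parent[OF *(1)] * by auto
qed (use assms in auto)

lemma ancestor_root:
  assumes "u \<in> V"
  shows "(par ^^ h u) u = r"
  using ancestor[OF assms order_refl] height_parent by fastforce

lemma walk_to_ancestor:
  assumes "u \<in> V" "a \<le> h u"
  shows "\<exists>q. G.awalk u q ((par ^^ a) u) \<and> length q = a"
    and "\<exists>q. G.awalk ((par ^^ a) u) q u \<and> length q = a"
  using assms(2)
proof (induction a)
  case 0
  { case 1 show ?case using assms(1) by (auto simp: G.awalk_Nil_iff pverts_T intro!: exI[of _ "[]"]) }
  { case 2 show ?case using assms(1) by (auto simp: G.awalk_Nil_iff pverts_T intro!: exI[of _ "[]"]) }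
next
  case (Suc a)
  let ?w = "(par ^^ a) u"
  have w: "?w \<in> V - {r}" "par ?w \<in> V" if "Suc a \<le> h u"
    using that ancestor[of u a] ancestor[of u "Suc a"] assms(1) height_root by auto
  { case 1
    then obtain q where q: "G.awalk u q ?w" "length q = a" using Suc.IH by auto
    have "G.awalk ?w [(?w, par ?w)] (par ?w)"
      using w[OF 1] by (auto simp: G.awalk_simps parcs_T_iff pverts_T)
    with q show ?case by (intro exI[of _ "q @ [(?w, par ?w)]"]) auto }
  { case 2
    then obtain q where q: "G.awalk ?w q u" "length q = a" using Suc.IH by auto
    have "(par ?w, ?w) \<in> parcs T" using w[OF 2] by (auto simp: parcs_T_iff)
    with q show ?case by (intro exI[of _ "(par ?w, ?w) # q"]) (auto simp: G.awalk_simps) }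
qed

lemma walk_via_common_ancestor:
  assumes "u \<in> V" "a \<le> h u" "v \<in> V" "b \<le> h v" "(par ^^ a) u = (par ^^ b) v"
  shows "\<exists>q. G.awalk u q v \<and> length q = a + b"
proof -
  obtain q q' where "G.awalk u q ((par ^^ a) u)" "length q = a"
      "G.awalk ((par ^^ a) u) q' v" "length q' = b"
    using walk_to_ancestor(1)[OF assms(1,2)] walk_to_ancestor(2)[OF assms(3,4)] assms(5) by metis
  then show ?thesis by (intro exI[of _ "q @ q'"]) auto
qed

subsection \<open>Connectedness and acyclicity\<close>

lemma connected_T: "connected (with_proj T)"
  unfolding connected_def
proof (rule strongly_connectedI)
  show "verts (with_proj (mk_symmetric (with_proj T))) \<noteq> {}"
    using root_in by (auto simp: mk_symmetric_def pverts_T)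
next
  fix u v assume "u \<in> verts (with_proj (mk_symmetric (with_proj T)))"
    "v \<in> verts (with_proj (mk_symmetric (with_proj T)))"
  then have "u \<in> V" "v \<in> V" by (auto simp: mk_symmetric_def pverts_T)
  then obtain q where "G.awalk u q v"
    using walk_via_common_ancestor[of u "h u" v "h v"] ancestor_root by auto
  then show "u \<rightarrow>\<^sup>*\<^bsub>with_proj (mk_symmetric (with_proj T))\<^esub> v"
    by (intro G.reachable_mk_symmetricI) (auto simp: G.reachable_awalk)
qed

text \<open>
  On a cycle of length at least 3, a vertex of maximal height has two different neighbours on the
  cycle; neither is a child of that vertex, so both would have to be its unique parent.
\<close>

lemma cycle_length:
  assumes "G.cycle p"
  shows "length p \<le> 2"
proof -
  define n where "n = length p"
  obtain u where p: "G.awalk u p u" "distinct (tl (pawalk_verts u p))" "p \<noteq> []"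
    using assms unfolding G.cycle_def by auto
  have n: "n > 0" using p(3) n_def by simp
  have verts: "tl (pawalk_verts x q) = map snd q" if "pcas x q y" for x q y
    using that
  proof (induction q arbitrary: x)
    case (Cons e q)
    then have "pcas (snd e) q y" by simp
    moreover have "pawalk_verts (snd e) q = snd e # tl (pawalk_verts (snd e) q)" by (cases q) (use calculation in auto)
    ultimately show ?case using Cons by auto
  qed simp
  have cas: "pcas u p u" and arcs: "set p \<subseteq> parcs T"
    using p(1) by (auto simp: G.awalk_def)
  have dist: "distinct (map snd p)" using p(2) verts[OF cas] by simp
  have step: "Suc i < length q \<longrightarrow> fst (q ! Suc i) = snd (q ! i)" if "pcas x q y" for x q y i
    using that
  proof (induction q arbitrary: x i)
    case (Cons e q)
    then show ?case by (cases i; cases q) auto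
  qed simp
  have ends: "q \<noteq> [] \<Longrightarrow> fst (hd q) = x \<and> snd (last q) = y" if "pcas x q y" for x q y
    using that by (induction q arbitrary: x) auto
  \<comment> \<open>Indexing the vertices of the cycle by all natural numbers, periodically, spares the treatment
    of the point where the cycle closes.\<close>
  define w where "w i = snd (p ! (i mod n))" for i
  have "p ! (Suc i mod n) = (w i, w (Suc i))" for i
  proof (cases "Suc (i mod n) = n")
    case True
    then have "Suc i mod n = 0" "i mod n = n - 1" by (auto simp: mod_Suc)
    then show ?thesis using ends[OF cas p(3)] p(3)
      by (auto simp: w_def n_def hd_conv_nth last_conv_nth prod_eq_iff)
  next
    case False
    then have "Suc i mod n = Suc (i mod n)" by (auto simp: mod_Suc)
    moreover have "Suc (i mod n) < n" using False n by (meson Suc_lessI mod_less_divisor)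
    ultimately show ?thesis using step[OF cas, of "i mod n"] by (auto simp: w_def n_def prod_eq_iff)
  qed
  then have arc: "(w i, w (Suc i)) \<in> parcs T" for i
    using arcs n by (metis mod_less_divisor n_def nth_mem subsetD)
  have inj: "i mod n = j mod n" if "w i = w j" for i j
    using that dist n nth_eq_iff_index_eq[OF dist, of "i mod n" "j mod n"] by (simp add: w_def n_def)
  have "finite (h ` range w)"
    by (rule finite_imageI, rule finite_subset[of _ "snd ` set p"]) (use n in \<open>auto simp: w_def n_def\<close>)
  then obtain m where m: "h (w i) \<le> h (w m)" for i
    using Max_in[of "h ` range w"] Max_ge[of "h ` range w"] by fastforce
  \<comment> \<open>The position before \<open>m\<close>, shifted by one period so that it exists also for \<open>m = 0\<close>.\<close>
  define i where "i = m + n - 1"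
  have "w (Suc i) = w m" using n by (simp add: w_def i_def)
  then have "w i = par (w (Suc i))" "w (Suc (Suc i)) = par (w (Suc i))"
    using arc[of i] arc[of "Suc i"] m[of i] m[of "Suc (Suc i)"]
    by (auto simp: parcs_T_iff dest: height_parent)
  then have "i mod n = (i + 2) mod n" using inj[of i "i + 2"] by simp
  then have "n dvd (i + 2) - i" by (metis mod_eq_dvd_iff_nat le_add1)
  then show ?thesis unfolding n_def[symmetric] by (simp add: dvd_imp_le)
qed

lemma undirected_tree_T: "undirected_tree T"
  unfolding undirected_tree_def using pair_graph_T connected_T cycle_length by force

text \<open>
  A vertex other than the root is a leaf iff it has no child. The two children \<open>a\<close> and \<open>b\<close>
  prevent the root from being a leaf.
\<close>

lemma leaves_T:
  assumes "a \<in> V - {r}" "b \<in> V - {r}" "a \<noteq> b" "par a = r" "par b = r"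
  shows "leaves T = V - par ` (V - {r})"
proof -
  have deg: "out_degree (with_proj T) v = card {w. (v, w) \<in> parcs T}" for v
  proof -
    have "out_arcs (with_proj T) v = Pair v ` {w. (v, w) \<in> parcs T}"
      by (auto simp: out_arcs_def)
    then show ?thesis by (simp add: out_degree_def card_image inj_on_def)
  qed
  have fin: "finite {w. (v, w) \<in> parcs T}" for v
    by (rule finite_subset[OF _ finite_V]) (auto dest: G.in_arcsD2 simp: pverts_T)
  have two: "out_degree (with_proj T) v \<noteq> 1"
    if "(v, c) \<in> parcs T" "(v, d) \<in> parcs T" "c \<noteq> d" for v c d
  proof
    assume "out_degree (with_proj T) v = 1"
    then obtain z where "{w. (v, w) \<in> parcs T} = {z}"
      unfolding deg by (auto simp: card_1_singleton_iff)
    then have "c \<in> {z}" "d \<in> {z}" using that(1,2) by blast+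
    then show False using that(3) by simp
  qed
  have inner: "out_degree (with_proj T) (par c) \<noteq> 1" if "c \<in> V - {r}" for c
  proof (cases "par c = r")
    case True
    then show ?thesis using two[of r a b] assms by (auto simp: parcs_T_iff)
  next
    case False
    have "par (par c) \<noteq> c"
      using that False height_parent[of c] height_parent[of "par c"] parent_in[of c] by auto
    then show ?thesis
      using two[of "par c" c "par (par c)"] that False parent_in by (auto simp: parcs_T_iff)
  qed
  have outer: "out_degree (with_proj T) v = 1" if "v \<in> V" "v \<notin> par ` (V - {r})" for v
  proof -
    have "v \<noteq> r" using that assms by force
    then have "{w. (v, w) \<in> parcs T} = {par v}" using that by (auto simp: parcs_T_iff)
    then show ?thesis by (simp add: deg)
  qed
  have "pverts T \<noteq> {v}" for v using assms by (auto simp: pverts_T)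
  then show ?thesis using inner outer by (auto simp: leaves_def pverts_T)
qed

subsection \<open>Distances\<close>

lemma awalk_cost_eq_length: "G.awalk_cost (\<lambda>_. 1) q = real (length q)"
  by (induction q) auto

lemma graph_dist_le:
  assumes "u \<in> V" "a \<le> h u" "v \<in> V" "b \<le> h v" "(par ^^ a) u = (par ^^ b) v"
  shows "graph_dist T u v \<le> ereal (real (a + b))"
  using walk_via_common_ancestor[OF assms] unfolding graph_dist_def
  by (metis G.min_cost_le_walk_cost awalk_cost_eq_length)

text \<open>
  A potential that changes by at most 1 along every edge bounds the distance from below. This
  replaces a discussion of the unique path between two vertices.
\<close>

lemma graph_dist_ge:
  fixes f :: "'v \<Rightarrow> int"
  assumes "\<And>w. w \<in> V - {r} \<Longrightarrow> \<bar>f w - f (par w)\<bar> \<le> 1"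
  shows "ereal (real_of_int (f v - f u)) \<le> graph_dist T u v"
proof -
  have "f v - f u \<le> int (length q)" if "G.awalk u q v" for q
    using that
  proof (induction q arbitrary: u)
    case (Cons e q)
    then have "f v - f (snd e) \<le> int (length q)" "(u, snd e) \<in> parcs T"
      by (auto simp: G.awalk_simps)
    moreover have "\<bar>f u - f (snd e)\<bar> \<le> 1"
      using calculation(2) assms by (fastforce simp: parcs_T_iff abs_minus_commute)
    ultimately show ?case by simp
  qed (simp add: G.awalk_simps)
  then show ?thesis
    unfolding graph_dist_def G.\<mu>_def awalk_cost_eq_length
    by (intro INF_greatest) (force simp: of_int_le_iff[where 'a=real, symmetric])
qed

text \<open>
  Here \<open>\<beta>\<close> names the subtree below the root in which a vertex lies. The height, with its sign
  reversed outside the branch of \<open>v\<close>, is a potential, because the sign can only change at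
  the root, where the height is 0.
\<close>

lemma graph_dist_different_branches:
  assumes branch: "\<And>w. w \<in> V - {r} \<Longrightarrow> par w \<noteq> r \<Longrightarrow> \<beta> (par w) = \<beta> w"
    and "u \<in> V" "v \<in> V" "\<beta> u \<noteq> \<beta> v"
  shows "graph_dist T u v = ereal (real (h u + h v))"
proof (rule antisym)
  show "graph_dist T u v \<le> ereal (real (h u + h v))"
    using assms ancestor_root by (intro graph_dist_le) auto
  define f where "f w = (if \<beta> w = \<beta> v then int (h w) else - int (h w))" for w
  have "\<bar>f w - f (par w)\<bar> \<le> 1" if "w \<in> V - {r}" for w
    using that branch[OF that] height_parent[of w] height_root
    by (cases "par w = r") (auto simp: f_def)
  from graph_dist_ge[of f v u, OF this]
  show "ereal (real (h u + h v)) \<le> graph_dist T u v"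
    using assms by (auto simp: f_def add.commute)
qed

end

section \<open>Brooms joined at a centre\<close>

text \<open>
  Internal vertices are pairs of a branch and a depth, coded as natural numbers. All branches
  share their vertex at depth 0, the centre.
\<close>

definition node :: "nat \<Rightarrow> nat \<Rightarrow> 'a + nat" where
  "node i d = Inr (prod_encode (if d = 0 then 0 else i, d))"

text \<open>
  A vertex \<open>v\<close> hangs as a leaf on the branch \<open>\<phi> v\<close>, from the node at depth \<open>l v\<close>.
\<close>

fun broom_parent :: "('a \<Rightarrow> nat) \<Rightarrow> ('a \<Rightarrow> nat) \<Rightarrow> 'a + nat \<Rightarrow> 'a + nat" where
  "broom_parent \<phi> l (Inl v) = node (\<phi> v) (l v)"
| "broom_parent \<phi> l (Inr m) = node (fst (prod_decode m)) (snd (prod_decode m) - 1)"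

fun broom_height :: "('a \<Rightarrow> nat) \<Rightarrow> 'a + nat \<Rightarrow> nat" where
  "broom_height l (Inl v) = Suc (l v)"
| "broom_height l (Inr m) = snd (prod_decode m)"

fun broom_branch :: "('a \<Rightarrow> nat) \<Rightarrow> 'a + nat \<Rightarrow> nat" where
  "broom_branch \<phi> (Inl v) = \<phi> v"
| "broom_branch \<phi> (Inr m) = fst (prod_decode m)"

definition broom_verts :: "'a set \<Rightarrow> ('a \<Rightarrow> nat) \<Rightarrow> ('a \<Rightarrow> nat) \<Rightarrow> ('a + nat) set" where
  "broom_verts P \<phi> l = Inl ` P \<union> (\<Union>v\<in>P. node (\<phi> v) ` {..l v})"

lemma node_eq_iff: "node i d = node j e \<longleftrightarrow> d = e \<and> (d = 0 \<or> i = j)"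
  by (auto simp: node_def)

lemma broom_parent_node: "broom_parent \<phi> l (node i d) = node i (d - 1)"
  by (auto simp: node_def)

lemma broom_height_node: "broom_height l (node i d) = d"
  by (auto simp: node_def)

lemma broom_branch_node: "d > 0 \<Longrightarrow> broom_branch \<phi> (node i d) = i"
  by (auto simp: node_def)

lemma node_ne_Inl: "node i d \<noteq> Inl v" "Inl v \<noteq> node i d"
  by (auto simp: node_def)

lemmas broom_simps = node_eq_iff broom_parent_node broom_height_node broom_branch_node node_ne_Inl

text \<open>
  Leaves with different labels are joined through the centre. Two leaves with the same label
  are joined by the part of their branch between the two nodes from which they hang; only the
  upper bound matters, as all these distances will be below \<open>k\<close>. The condition \<open>l v > 0\<close> keeps
  every leaf inside its branch, and it ensures that each of two labels contributes a
  neighbour of the centre.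
\<close>

lemma distances_in_broom_tree:
  fixes \<phi> l :: "'a \<Rightarrow> nat"
  assumes "finite P" and l_pos: "\<And>v. v \<in> P \<Longrightarrow> l v > 0"
    and two: "a \<in> P" "b \<in> P" "\<phi> a \<noteq> \<phi> b"
  shows "\<exists>T :: ('a + nat) pair_pre_digraph. undirected_tree T \<and> leaves T = Inl ` P \<and>
    (\<forall>u\<in>P. \<forall>v\<in>P.
      (\<phi> u \<noteq> \<phi> v \<longrightarrow> graph_dist T (Inl u) (Inl v) = ereal (real (l u + l v + 2))) \<and>
      (\<phi> u = \<phi> v \<longrightarrow>
        graph_dist T (Inl u) (Inl v) \<le> ereal (real (max (l u) (l v) - min (l u) (l v) + 2))))"
proof -
  define V where "V = broom_verts P \<phi> l"
  have V_cases: "(\<exists>v\<in>P. w = Inl v) \<or> (\<exists>v\<in>P. \<exists>d\<le>l v. w = node (\<phi> v) d)" if "w \<in> V" for w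
    using that by (auto simp: V_def broom_verts_def)
  have Inl_V: "Inl v \<in> V" if "v \<in> P" for v
    using that by (auto simp: V_def broom_verts_def)
  have node_V: "node (\<phi> v) d \<in> V" if "v \<in> P" "d \<le> l v" for v d
    using that by (auto simp: V_def broom_verts_def)
  let ?r = "node 0 0 :: 'a + nat"
  have root: "node i 0 = ?r" for i
    by (simp add: node_eq_iff)
  interpret rooted_tree V ?r "broom_parent \<phi> l" "broom_height l"
  proof
    show "finite V" using assms(1) by (simp add: V_def broom_verts_def)
    show "?r \<in> V" using node_V[OF two(1) le0] root by metis
    show "broom_height l ?r = 0" by (simp add: broom_height_node)
  next
    fix w assume w: "w \<in> V" "w \<noteq> ?r"
    from V_cases[OF w(1)]
    show "broom_parent \<phi> l w \<in> V" by (auto simp: broom_simps intro!: node_V)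
    from V_cases[OF w(1)]
    show "broom_height l w = Suc (broom_height l (broom_parent \<phi> l w))"
      using w(2) by (auto simp: broom_simps)
  qed
  have up: "(broom_parent \<phi> l ^^ Suc d) (Inl v) = node (\<phi> v) (l v - d)" for v d
    by (induction d) (auto simp: broom_simps)
  \<comment> \<open>The two children of the centre lie on the branches of \<open>a\<close> and \<open>b\<close>.\<close>
  have "leaves T = V - broom_parent \<phi> l ` (V - {?r})"
    using two l_pos node_V[OF two(1), of 1] node_V[OF two(2), of 1]
    by (intro leaves_T[of "node (\<phi> a) 1" "node (\<phi> b) 1"]) (auto simp: broom_simps Suc_le_eq)
  also have "\<dots> = Inl ` P"
  proof -
    have "node (\<phi> v) d \<in> broom_parent \<phi> l ` (V - {?r})" if "v \<in> P" "d \<le> l v" for v d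
    proof (cases "d = l v")
      case True
      then show ?thesis using Inl_V[OF that(1)]
        by (intro image_eqI[of _ _ "Inl v"]) (auto simp: broom_simps)
    next
      case False
      then show ?thesis using node_V[OF that(1), of "Suc d"] that
        by (intro image_eqI[of _ _ "node (\<phi> v) (Suc d)"]) (auto simp: broom_simps)
    qed
    then have "w \<in> Inl ` P" if "w \<in> V - broom_parent \<phi> l ` (V - {?r})" for w
      using V_cases[of w] that by auto
    moreover have "Inl v \<noteq> broom_parent \<phi> l w" for v w
      by (cases w) (auto simp: node_ne_Inl)
    then have "Inl v \<in> V - broom_parent \<phi> l ` (V - {?r})" if "v \<in> P" for v
      using Inl_V[OF that] by (simp add: image_iff)
    ultimately show ?thesis by (intro equalityI subsetI) (simp, elim imageE, simp)
  qed
  finally have leaves: "leaves T = Inl ` P" .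
  have branch: "broom_branch \<phi> (broom_parent \<phi> l w) = broom_branch \<phi> w"
    if "w \<in> V - {?r}" "broom_parent \<phi> l w \<noteq> ?r" for w
    using V_cases[of w] that l_pos by (auto simp: broom_simps)
  show ?thesis
  proof (intro exI[of _ T] conjI ballI impI)
    show "undirected_tree T" by (rule undirected_tree_T)
    show "leaves T = Inl ` P" by (rule leaves)
    fix u v assume uv: "u \<in> P" "v \<in> P"
    show "graph_dist T (Inl u) (Inl v) = ereal (real (l u + l v + 2))" if "\<phi> u \<noteq> \<phi> v"
      using graph_dist_different_branches[of "broom_branch \<phi>" "Inl u" "Inl v", OF branch] that uv Inl_V
      by auto
    \<comment> \<open>For equal labels, the lower of the two depths is where the walks from both leaves meet.\<close>
    define m where "m = min (l u) (l v)"
    show "graph_dist T (Inl u) (Inl v)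
        \<le> ereal (real (max (l u) (l v) - min (l u) (l v) + 2))" if "\<phi> u = \<phi> v"
    proof -
      have "(broom_parent \<phi> l ^^ Suc (l u - m)) (Inl u)
          = (broom_parent \<phi> l ^^ Suc (l v - m)) (Inl v)"
        unfolding up m_def using that by (simp add: min_def)
      from graph_dist_le[OF Inl_V[OF uv(1)] _ Inl_V[OF uv(2)] _ this]
      have "graph_dist T (Inl u) (Inl v) \<le> ereal (real (Suc (l u - m) + Suc (l v - m)))"
        by simp
      also have "Suc (l u - m) + Suc (l v - m) = max (l u) (l v) - min (l u) (l v) + 2"
        by (simp add: m_def min_def max_def)
      finally show ?thesis .
    qed
  qed
qed

section \<open>Co-cluster graphs as labelled graphs\<close>

text \<open>
  With hanging depths 1 on \<open>X\<close> and \<open>k - 3\<close> on \<open>Y\<close>, the distance \<open>l u + l v + 2\<close> between leaves on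
  different branches is \<open>k\<close> for one leaf from each side. Two leaves from the same side
  never reach \<open>k\<close> exactly, because \<open>2 * 2 < k\<close> and \<open>2 * (k - 2) > k\<close>.
\<close>

lemma exact_leaf_power_of_labelling:
  fixes G :: "'a pair_pre_digraph" and \<phi> :: "'a \<Rightarrow> nat"
  assumes G: "pair_graph G" and bip: "bipartition G X Y" and "k \<ge> 5"
    and adj: "\<And>x y. x \<in> X \<Longrightarrow> y \<in> Y \<Longrightarrow> (x, y) \<in> parcs G \<longleftrightarrow> \<phi> x \<noteq> \<phi> y"
    and two: "a \<in> pverts G" "b \<in> pverts G" "\<phi> a \<noteq> \<phi> b"
  shows "exact_leaf_power k G"
proof -
  interpret pair_graph G by fact
  define l where "l v = (if v \<in> X then 1 else k - 3)" for v
  have XY: "X \<union> Y = pverts G" "X \<inter> Y = {}" "parcs G \<subseteq> X \<times> Y \<union> Y \<times> X"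
    using bip by (auto simp: bipartition_def)
  have "\<And>v. v \<in> pverts G \<Longrightarrow> l v > 0" using \<open>k \<ge> 5\<close> by (auto simp: l_def)
  then have "\<exists>T :: ('a + nat) pair_pre_digraph. undirected_tree T \<and> leaves T = Inl ` pverts G \<and>
    (\<forall>u\<in>pverts G. \<forall>v\<in>pverts G.
      (\<phi> u \<noteq> \<phi> v \<longrightarrow> graph_dist T (Inl u) (Inl v) = ereal (real (l u + l v + 2))) \<and>
      (\<phi> u = \<phi> v \<longrightarrow>
        graph_dist T (Inl u) (Inl v) \<le> ereal (real (max (l u) (l v) - min (l u) (l v) + 2))))"
    by (intro distances_in_broom_tree[OF pair_finite_verts _ two])
  then obtain T :: "('a + nat) pair_pre_digraph"
    where T: "undirected_tree T" "leaves T = Inl ` pverts G"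
    and dist: "\<forall>u\<in>pverts G. \<forall>v\<in>pverts G.
      (\<phi> u \<noteq> \<phi> v \<longrightarrow> graph_dist T (Inl u) (Inl v) = ereal (real (l u + l v + 2))) \<and>
      (\<phi> u = \<phi> v \<longrightarrow>
        graph_dist T (Inl u) (Inl v) \<le> ereal (real (max (l u) (l v) - min (l u) (l v) + 2)))"
    by (elim exE conjE)
  have "(u, v) \<in> parcs G \<longleftrightarrow> graph_dist T (Inl u) (Inl v) = ereal (real k)"
    if uv: "u \<in> pverts G" "v \<in> pverts G" for u v
  proof -
    have edge: "(u, v) \<in> parcs G \<longleftrightarrow> \<phi> u \<noteq> \<phi> v \<and> (u \<in> X \<and> v \<in> Y \<or> u \<in> Y \<and> v \<in> X)"
    proof
      assume "(u, v) \<in> parcs G"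
      moreover from this have "(v, u) \<in> parcs G" by (rule arcs_symmetric)
      ultimately show "\<phi> u \<noteq> \<phi> v \<and> (u \<in> X \<and> v \<in> Y \<or> u \<in> Y \<and> v \<in> X)"
        using XY(3) adj[of u v] adj[of v u] by auto
    next
      assume "\<phi> u \<noteq> \<phi> v \<and> (u \<in> X \<and> v \<in> Y \<or> u \<in> Y \<and> v \<in> X)"
      then show "(u, v) \<in> parcs G"
        using adj[of u v] adj[of v u] arcs_symmetric[of v u] by auto
    qed
    note dist_uv = bspec[OF bspec[OF dist uv(1)] uv(2)]
    show ?thesis
    proof (cases "\<phi> u = \<phi> v")
      case True
      have "max (l u) (l v) - min (l u) (l v) + 2 < k"
        using \<open>k \<ge> 5\<close> by (auto simp: l_def)
      then have "ereal (real (max (l u) (l v) - min (l u) (l v) + 2)) < ereal (real k)"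
        by (simp only: ereal_less_eq less_ereal.simps of_nat_less_iff)
      with dist_uv True have "graph_dist T (Inl u) (Inl v) < ereal (real k)"
        by (meson le_less_trans)
      then show ?thesis using edge True by auto
    next
      case False
      have "l u + l v + 2 = k \<longleftrightarrow> u \<in> X \<and> v \<in> Y \<or> u \<in> Y \<and> v \<in> X"
        using uv XY(1,2) \<open>k \<ge> 5\<close> by (auto simp: l_def)
      moreover have "graph_dist T (Inl u) (Inl v) = ereal (real (l u + l v + 2))"
        using dist_uv False by blast
      ultimately show ?thesis using edge False by (simp only: ereal.inject of_nat_eq_iff) simp
    qed
  qed
  then show ?thesis
    unfolding exact_leaf_power_def by (intro exI[of _ T] conjI T) simp
qed

lemma the_class_index:
  assumes "disjoint_family_on C I" "i \<in> I" "v \<in> C i"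
  shows "(THE i. i \<in> I \<and> v \<in> C i) = i"
proof (rule the_equality)
  show "j = i" if "j \<in> I \<and> v \<in> C j" for j
    using that assms disjoint_family_onD[of C I i j] by blast
qed (use assms in simp)

text \<open>
  The classes \<open>A 0\<close> and \<open>B 0\<close> must not share a label, because their vertices are adjacent to
  every vertex on the other side.
\<close>

lemma co_cluster_labelling:
  assumes "bipartite_co_cluster G"
  shows "\<exists>X Y (\<phi> :: 'a \<Rightarrow> nat). bipartition G X Y \<and>
    (\<forall>x\<in>X. \<forall>y\<in>Y. (x, y) \<in> parcs G \<longleftrightarrow> \<phi> x \<noteq> \<phi> y)"
proof -
  obtain X Y t A B where bip: "bipartition G X Y"
    and X: "X = (\<Union>i\<in>{0..t}. A i)" "disjoint_family_on A {0..t}"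
    and Y: "Y = (\<Union>i\<in>{0..t}. B i)" "disjoint_family_on B {0..t}"
    and adj: "\<And>x y. x \<in> X \<Longrightarrow> y \<in> Y \<Longrightarrow> (x, y) \<notin> parcs G \<longleftrightarrow> (\<exists>i\<in>{1..t::nat}. x \<in> A i \<and> y \<in> B i)"
    using assms unfolding bipartite_co_cluster_def by blast
  define \<phi> where "\<phi> v = (if v \<in> X then THE i. i \<in> {0..t} \<and> v \<in> A i
      else if v \<in> B 0 then Suc t else THE i. i \<in> {0..t} \<and> v \<in> B i)" for v
  have A: "\<phi> x = i" if "x \<in> A i" "i \<in> {0..t}" for x i
    using the_class_index[OF X(2) that(2,1)] that X(1) by (auto simp: \<phi>_def)
  have notX: "y \<notin> X" if "y \<in> Y" for y using that bip by (auto simp: bipartition_def)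
  have B: "\<phi> y = (if i = 0 then Suc t else i)" if "y \<in> B i" "i \<in> {0..t}" for y i
  proof -
    have "y \<in> Y" using that unfolding Y(1) by (rule UN_I[rotated])
    then have "y \<notin> X" by (rule notX)
    moreover have "i = 0" if "y \<in> B 0"
      using disjoint_family_onD[OF Y(2), of i 0] that \<open>y \<in> B i\<close> \<open>i \<in> {0..t}\<close> by auto
    ultimately show ?thesis
      using the_class_index[OF Y(2) that(2,1)] that(1) by (cases "i = 0") (auto simp: \<phi>_def)
  qed
  have "(x, y) \<in> parcs G \<longleftrightarrow> \<phi> x \<noteq> \<phi> y" if xy: "x \<in> X" "y \<in> Y" for x y
  proof -
    obtain i j where ij: "x \<in> A i" "i \<in> {0..t}" "y \<in> B j" "j \<in> {0..t}"
      using xy unfolding X(1) Y(1) by (elim UN_E)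
    note labels = A[OF ij(1,2)] B[OF ij(3,4)]
    have "(\<exists>m\<in>{1..t}. x \<in> A m \<and> y \<in> B m) \<longleftrightarrow> \<phi> x = \<phi> y"
    proof
      assume "\<exists>m\<in>{1..t}. x \<in> A m \<and> y \<in> B m"
      then obtain m where m: "m \<in> {1..t}" "x \<in> A m" "y \<in> B m" by (elim bexE conjE)
      then show "\<phi> x = \<phi> y" using A[of x m] B[of y m] by simp
    next
      assume "\<phi> x = \<phi> y"
      then have "j = i" "i \<in> {1..t}" using labels ij(2,4) by (auto split: if_splits)
      then show "\<exists>m\<in>{1..t}. x \<in> A m \<and> y \<in> B m"
        using ij(1,3) by (intro bexI[of _ i]) simp_all
    qed
    then show ?thesis using adj[OF xy] by blast
  qed
  then show ?thesis using bip by (intro exI conjI ballI)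
qed

text \<open>
  Any bipartition suits an edgeless graph. If one side is empty, the condition on labels across
  the bipartition is vacuous, so the labels may be chosen pairwise distinct, and the
  construction needs just two of them.
\<close>

lemma exact_leaf_power_edgeless:
  assumes G: "pair_graph G" "pverts G \<noteq> {}" and "k \<ge> 5" and no_arcs: "parcs G = {}"
  shows "exact_leaf_power k G"
proof (cases "\<exists>v. pverts G = {v}")
  case True
  then obtain v where v: "pverts G = {v}" ..
  define T :: "('a + nat) pair_pre_digraph" where "T = parent_graph {Inl v} (Inl v) id"
  interpret rooted_tree "{Inl v :: 'a + nat}" "Inl v" id "\<lambda>_. 0"
    by unfold_locales auto
  have "undirected_tree T" using undirected_tree_T by (simp add: T_def)
  moreover have "leaves T = Inl ` pverts G" by (auto simp: leaves_def T_def pverts_T v)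
  ultimately show ?thesis unfolding exact_leaf_power_def v by (intro exI[of _ T]) auto
next
  case False
  then obtain a b where ab: "a \<in> pverts G" "b \<in> pverts G" "a \<noteq> b" using G(2) by blast
  interpret pair_graph G by fact
  obtain \<phi> :: "'a \<Rightarrow> nat" where "inj_on \<phi> (pverts G)"
    using finite_imp_inj_to_nat_seg[OF pair_finite_verts] by blast
  then have "\<phi> a \<noteq> \<phi> b" using ab by (auto dest: inj_onD)
  moreover have "bipartition G (pverts G) {}" by (simp add: bipartition_def no_arcs)
  ultimately show ?thesis using exact_leaf_power_of_labelling[OF G(1) _ \<open>k \<ge> 5\<close> _ ab(1,2), of _ "{}" \<phi>]
    by auto
qed

theorem theorem5p2:
  fixes G :: "'a pair_pre_digraph" and k :: nat
  assumes "pair_graph G" and "pverts G \<noteq> {}"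
    and "bipartite_co_cluster G"
    and "k \<ge> 5"
  shows "exact_leaf_power k G"
proof (cases "parcs G = {}")
  case True
  then show ?thesis using exact_leaf_power_edgeless assms by blast
next
  case False
  interpret pair_graph G by fact
  obtain X Y and \<phi> :: "'a \<Rightarrow> nat" where bip: "bipartition G X Y"
    and adj: "\<forall>x\<in>X. \<forall>y\<in>Y. (x, y) \<in> parcs G \<longleftrightarrow> \<phi> x \<noteq> \<phi> y"
    using co_cluster_labelling[OF assms(3)] by (elim exE conjE)
  from False obtain x y where "(x, y) \<in> parcs G" by auto
  then have verts: "x \<in> pverts G" "y \<in> pverts G"
    and "x \<in> X \<and> y \<in> Y \<or> y \<in> X \<and> x \<in> Y" "(y, x) \<in> parcs G"
    using bip in_arcsD1 in_arcsD2 arcs_symmetric[of x y] by (auto simp: bipartition_def)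
  then have "\<phi> x \<noteq> \<phi> y" using adj \<open>(x, y) \<in> parcs G\<close> by metis
  with verts adj show ?thesis
    by (intro exact_leaf_power_of_labelling[OF assms(1) bip assms(4)]) simp_all
qed

end
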